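(* Let $K$ be a normal subgroup of a group $G$. Then $FC_G(K)\neq\{1\}$ if and only if one of the following conditions occurs: (i) $K$ contains a non-trivial finite subgroup that is normal in $G$; (ii) $K$ contains a non-trivial free Abelian subgroup $\mathbb{Z}^n$ (of finite rank $n$) that is normal in $G$ and such that the induced homomorphism $G\to GL(n,\mathbb{Z})$ has a finite image.
   Context: $FC_G(K)=\{u\in K:\ \text{the conjugacy class of } u \text{ in } G \text{ is finite}\}$. In (ii) the induced homomorphism is the action of $G$ by conjugation on the normal subgroup $\mathbb{Z}^n$, after identifying $\mathrm{Aut}(\mathbb{Z}^n)$ with $GL(n,\mathbb{Z})$. *)

theory Defs
  imports "HOL-Algebra.Group_Action" "Jordan_Normal_Form.Matrix"
begin

definition conj_action :: "('a, 'b) monoid_scheme \<Rightarrow> 'a set \<Rightarrow> 'a \<Rightarrow> 'a \<Rightarrow> 'a" where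
  "conj_action G N g = (\<lambda>h\<in>N. g \<otimes>\<^bsub>G\<^esub> h \<otimes>\<^bsub>G\<^esub> inv\<^bsub>G\<^esub> g)"

definition conjugacy_class :: "('a, 'b) monoid_scheme \<Rightarrow> 'a \<Rightarrow> 'a set" where
  "conjugacy_class G u = orbit G (conj_action G (carrier G)) u"

definition FC :: "('a, 'b) monoid_scheme \<Rightarrow> 'a set \<Rightarrow> 'a set" where
  "FC G K = {u \<in> K. finite (conjugacy_class G u)}"

abbreviation Zn :: "nat \<Rightarrow> int vec monoid" where
  "Zn n \<equiv> monoid_vec TYPE(int) n"

definition GLZ :: "nat \<Rightarrow> int mat monoid" where
  "GLZ n = units_of (ring_mat TYPE(int) n ())"

text \<open>An isomorphism \<open>\<phi>\<close> from \<open>Zn n\<close> onto a group \<open>A\<close> (equivalently, a \<open>\<int>\<close>-basis of \<open>A\<close>)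
  identifies the automorphisms of \<open>A\<close> with matrices: column \<open>j\<close> holds the
  \<open>\<phi>\<close>-coordinates of the image of the \<open>j\<close>-th basis element.\<close>

definition aut_matrix :: "nat \<Rightarrow> (int vec \<Rightarrow> 'a) \<Rightarrow> ('a \<Rightarrow> 'a) \<Rightarrow> int mat" where
  "aut_matrix n \<phi> \<alpha> =
     mat_of_cols n (map (\<lambda>j. inv_into (carrier_vec n) \<phi> (\<alpha> (\<phi> (unit_vec n j)))) [0..<n])"

definition induced_hom ::
    "('a, 'b) monoid_scheme \<Rightarrow> 'a set \<Rightarrow> nat \<Rightarrow> (int vec \<Rightarrow> 'a) \<Rightarrow> 'a \<Rightarrow> int mat" where
  "induced_hom G A n \<phi> g = aut_matrix n \<phi> (conj_action G A g)"

text \<open>The matrix represents the given map in coordinates, and the induced map is a homomorphism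
  into \<open>GL(n, \<int>)\<close>.\<close>

lemma additive_eq_mat_of_cols:
  fixes f :: "int vec \<Rightarrow> int vec"
  assumes cl: "\<And>v. v \<in> carrier_vec n \<Longrightarrow> f v \<in> carrier_vec n"
    and add: "\<And>v w. v \<in> carrier_vec n \<Longrightarrow> w \<in> carrier_vec n \<Longrightarrow> f (v + w) = f v + f w"
    and v: "v \<in> carrier_vec n"
  shows "mat_of_cols n (map (\<lambda>j. f (unit_vec n j)) [0..<n]) *\<^sub>v v = f v"
proof -
  have f0: "f (0\<^sub>v n) = 0\<^sub>v n"
  proof -
    have eq: "f (0\<^sub>v n + 0\<^sub>v n) = f (0\<^sub>v n) + f (0\<^sub>v n)"
      by (rule add) simp_all
    have "f (0\<^sub>v n) $ i = 0" if "i < n" for i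
      using arg_cong[OF eq, of "\<lambda>x. x $ i"] that cl[of "0\<^sub>v n"] by simp
    then show ?thesis using cl[of "0\<^sub>v n"] by (intro eq_vecI) auto
  qed
  have smn: "f (int k \<cdot>\<^sub>v w) = int k \<cdot>\<^sub>v f w" if w: "w \<in> carrier_vec n" for k w
  proof (induction k)
    case 0
    have "(0::int) \<cdot>\<^sub>v w = 0\<^sub>v n" "(0::int) \<cdot>\<^sub>v f w = 0\<^sub>v n" using w cl[OF w] by auto
    then show ?case using f0 by simp
  next
    case (Suc k)
    have "int (Suc k) \<cdot>\<^sub>v w = int k \<cdot>\<^sub>v w + w"
      using w by (intro eq_vecI) (auto simp: algebra_simps)
    moreover have "int (Suc k) \<cdot>\<^sub>v f w = int k \<cdot>\<^sub>v f w + f w"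
      using cl[OF w] by (intro eq_vecI) (auto simp: algebra_simps)
    ultimately show ?case using Suc w add by simp
  qed
  have fneg: "f (- w) = - f w" if w: "w \<in> carrier_vec n" for w
  proof -
    have "f (- w) + f w = 0\<^sub>v n" using add[of "- w" w] w f0 by simp
    then have "(f (- w) + f w) $ i = 0" if "i < n" for i using that by simp
    then show ?thesis
      using cl[OF w] cl[of "- w"] w
      by (intro eq_vecI) (auto simp: eq_neg_iff_add_eq_0)
  qed
  have sm: "f (a \<cdot>\<^sub>v w) = a \<cdot>\<^sub>v f w" if w: "w \<in> carrier_vec n" for a w
  proof (cases "a \<ge> 0")
    case True
    then show ?thesis using smn[OF w, of "nat a"] by simp
  next
    case False
    have 1: "a \<cdot>\<^sub>v w = - (int (nat (- a)) \<cdot>\<^sub>v w)" "a \<cdot>\<^sub>v f w = - (int (nat (- a)) \<cdot>\<^sub>v f w)"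
      using False w cl[OF w] by auto
    show ?thesis unfolding 1 using w by (simp only: fneg smn smult_carrier_vec)
  qed
  have part: "f (vec n (\<lambda>j. if j < k then v $ j else 0)) $ i = (\<Sum>j<k. f (unit_vec n j) $ i * v $ j)"
    if i: "i < n" and "k \<le> n" for i k
    using \<open>k \<le> n\<close>
  proof (induction k)
    case 0
    have "vec n (\<lambda>j. if j < 0 then v $ j else 0) = 0\<^sub>v n" by auto
    then show ?case using f0 i by simp
  next
    case (Suc k)
    have "vec n (\<lambda>j. if j < Suc k then v $ j else 0)
        = vec n (\<lambda>j. if j < k then v $ j else 0) + v $ k \<cdot>\<^sub>v unit_vec n k"
      using Suc.prems by (intro eq_vecI) (auto simp: less_Suc_eq)
    moreover have "f (unit_vec n k) \<in> carrier_vec n" using cl by simp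
    ultimately show ?case using Suc i by (simp add: add sm)
  qed
  have "vec n (\<lambda>j. if j < n then v $ j else 0) = v" using v by auto
  then have fv: "f v $ i = (\<Sum>j<n. f (unit_vec n j) $ i * v $ j)" if "i < n" for i
    using part[OF that, of n] by simp
  show ?thesis
  proof (rule eq_vecI)
    fix i assume "i < dim_vec (f v)"
    then have i: "i < n" using cl[OF v] by simp
    show "(mat_of_cols n (map (\<lambda>j. f (unit_vec n j)) [0..<n]) *\<^sub>v v) $ i = f v $ i"
      using i v by (simp add: fv scalar_prod_def mat_of_cols_index atLeast0LessThan)
  qed (use cl[OF v] in simp)
qed

lemma aut_matrix_carrier: "aut_matrix n \<phi> \<alpha> \<in> carrier_mat n n"
  by (rule carrier_matI) (simp_all add: aut_matrix_def)

lemma aut_matrix_mult_vec: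
  assumes H: "group H" and \<phi>: "\<phi> \<in> iso (Zn n) H" and \<alpha>: "\<alpha> \<in> hom H H"
    and v: "v \<in> carrier_vec n"
  shows "\<phi> (aut_matrix n \<phi> \<alpha> *\<^sub>v v) = \<alpha> (\<phi> v)"
proof -
  have bij: "bij_betw \<phi> (carrier_vec n) (carrier H)" and
    \<phi>add: "\<And>v w. v \<in> carrier_vec n \<Longrightarrow> w \<in> carrier_vec n \<Longrightarrow> \<phi> (v + w) = \<phi> v \<otimes>\<^bsub>H\<^esub> \<phi> w"
    using \<phi> by (auto simp: iso_def hom_def monoid_vec_simps)
  have \<phi>cl: "\<phi> w \<in> carrier H" if "w \<in> carrier_vec n" for w
    using bij that by (rule bij_betwE[THEN bspec])
  have \<alpha>cl: "\<alpha> h \<in> carrier H" if "h \<in> carrier H" for h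
    using \<alpha> that by (rule hom_in_carrier)
  let ?\<psi> = "inv_into (carrier_vec n) \<phi>"
  have r: "\<phi> (?\<psi> h) = h" if "h \<in> carrier H" for h
    using bij_betw_inv_into_right[OF bij that] .
  have \<psi>cl: "?\<psi> h \<in> carrier_vec n" if "h \<in> carrier H" for h
    using bij_betw_inv_into[OF bij] that by (auto dest: bij_betwE)
  have \<psi>mult: "?\<psi> (g \<otimes>\<^bsub>H\<^esub> h) = ?\<psi> g + ?\<psi> h" if "g \<in> carrier H" "h \<in> carrier H" for g h
  proof -
    have "\<phi> (?\<psi> g + ?\<psi> h) = g \<otimes>\<^bsub>H\<^esub> h" using that by (simp add: \<phi>add \<psi>cl r)
    then show ?thesis
      using bij_betw_inv_into_left[OF bij, of "?\<psi> g + ?\<psi> h"] that \<psi>cl by simp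
  qed
  have "aut_matrix n \<phi> \<alpha> *\<^sub>v v = ?\<psi> (\<alpha> (\<phi> v))"
    unfolding aut_matrix_def
    by (rule additive_eq_mat_of_cols[where f = "\<lambda>v. ?\<psi> (\<alpha> (\<phi> v))", OF _ _ v])
      (use \<alpha> in \<open>simp_all add: \<psi>cl \<alpha>cl \<phi>cl \<phi>add hom_mult \<psi>mult\<close>)
  then show ?thesis using v by (simp add: r \<alpha>cl \<phi>cl)
qed

lemma induced_hom_in_hom:
  assumes A: "A \<lhd> G" and \<phi>: "\<phi> \<in> iso (Zn n) (G\<lparr>carrier := A\<rparr>)"
  shows "induced_hom G A n \<phi> \<in> hom G (GLZ n)"
    and "\<And>g v. g \<in> carrier G \<Longrightarrow> v \<in> carrier_vec n \<Longrightarrow>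
           \<phi> (induced_hom G A n \<phi> g *\<^sub>v v) = g \<otimes>\<^bsub>G\<^esub> \<phi> v \<otimes>\<^bsub>G\<^esub> inv\<^bsub>G\<^esub> g"
proof -
  interpret normal A G by (fact A)
  have H: "group (G\<lparr>carrier := A\<rparr>)" by (rule subgroup_imp_group) (rule is_subgroup)
  let ?M = "induced_hom G A n \<phi>"
  have bij: "bij_betw \<phi> (carrier_vec n) A"
    using \<phi> by (auto simp: iso_def monoid_vec_simps)
  have \<phi>A: "\<phi> v \<in> A" if "v \<in> carrier_vec n" for v
    using bij that by (rule bij_betwE[THEN bspec])
  have \<phi>cl: "\<phi> v \<in> carrier G" if "v \<in> carrier_vec n" for v
    using \<phi>A[OF that] by (rule mem_carrier)
  have cc: "g \<otimes>\<^bsub>G\<^esub> h \<otimes>\<^bsub>G\<^esub> inv\<^bsub>G\<^esub> g \<in> A" if "g \<in> carrier G" "h \<in> A" for g h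
    using inv_op_closed2 that by blast
  have ch: "conj_action G A g \<in> hom (G\<lparr>carrier := A\<rparr>) (G\<lparr>carrier := A\<rparr>)" if g: "g \<in> carrier G" for g
  proof (rule homI)
    fix x y assume "x \<in> carrier (G\<lparr>carrier := A\<rparr>)" "y \<in> carrier (G\<lparr>carrier := A\<rparr>)"
    then have xy: "x \<in> A" "y \<in> A" "x \<in> carrier G" "y \<in> carrier G" by auto
    have "g \<otimes>\<^bsub>G\<^esub> (x \<otimes>\<^bsub>G\<^esub> y) \<otimes>\<^bsub>G\<^esub> inv\<^bsub>G\<^esub> g
        = (g \<otimes>\<^bsub>G\<^esub> x \<otimes>\<^bsub>G\<^esub> inv\<^bsub>G\<^esub> g) \<otimes>\<^bsub>G\<^esub> (g \<otimes>\<^bsub>G\<^esub> y \<otimes>\<^bsub>G\<^esub> inv\<^bsub>G\<^esub> g)"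
      using g xy by (simp add: m_assoc inv_solve_left' inv_solve_left)
    then show "conj_action G A g (x \<otimes>\<^bsub>G\<lparr>carrier := A\<rparr>\<^esub> y)
        = conj_action G A g x \<otimes>\<^bsub>G\<lparr>carrier := A\<rparr>\<^esub> conj_action G A g y"
      using xy by (simp add: conj_action_def)
  qed (use g cc in \<open>auto simp: conj_action_def\<close>)
  show M: "\<phi> (?M g *\<^sub>v v) = g \<otimes>\<^bsub>G\<^esub> \<phi> v \<otimes>\<^bsub>G\<^esub> inv\<^bsub>G\<^esub> g" if "g \<in> carrier G" "v \<in> carrier_vec n" for g v
    unfolding induced_hom_def using aut_matrix_mult_vec[OF H \<phi> ch[OF that(1)] that(2)] \<phi>A[OF that(2)]
    by (simp add: conj_action_def)
  have Mc: "?M g \<in> carrier_mat n n" for g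
    unfolding induced_hom_def by (rule aut_matrix_carrier)
  have inj: "v = w" if "\<phi> v = \<phi> w" "v \<in> carrier_vec n" "w \<in> carrier_vec n" for v w
    using bij that by (meson bij_betw_imp_inj_on inj_onD)
  have ext: "P = Q" if PQ: "P \<in> carrier_mat n n" "Q \<in> carrier_mat n n"
    and eq: "\<And>v. v \<in> carrier_vec n \<Longrightarrow> P *\<^sub>v v = Q *\<^sub>v v" for P Q :: "int mat"
  proof (rule eq_matI)
    fix i j assume "i < dim_row Q" "j < dim_col Q"
    then have ij: "i < n" "j < n" using PQ by auto
    have "(P *\<^sub>v unit_vec n j) $ i = (Q *\<^sub>v unit_vec n j) $ i" using eq by simp
    then show "P $$ (i, j) = Q $$ (i, j)" using PQ ij by simp
  qed (use PQ in auto)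
  have mult: "?M (g \<otimes>\<^bsub>G\<^esub> h) = ?M g * ?M h" if g: "g \<in> carrier G" and h: "h \<in> carrier G" for g h
  proof (rule ext)
    fix v :: "int vec" assume v: "v \<in> carrier_vec n"
    have Mv: "?M h *\<^sub>v v \<in> carrier_vec n" using Mc v by (rule mult_mat_vec_carrier)
    have "\<phi> (?M (g \<otimes>\<^bsub>G\<^esub> h) *\<^sub>v v) = \<phi> (?M g *\<^sub>v (?M h *\<^sub>v v))"
      using g h v Mv \<phi>cl[OF v] by (simp add: M inv_mult_group m_assoc)
    then have "?M (g \<otimes>\<^bsub>G\<^esub> h) *\<^sub>v v = ?M g *\<^sub>v (?M h *\<^sub>v v)"
      by (rule inj) (use Mc v Mv in \<open>auto intro: mult_mat_vec_carrier\<close>)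
    then show "?M (g \<otimes>\<^bsub>G\<^esub> h) *\<^sub>v v = (?M g * ?M h) *\<^sub>v v"
      using assoc_mult_mat_vec[OF Mc Mc v] by simp
  qed (use Mc in \<open>auto intro: mult_carrier_mat\<close>)
  have one: "?M \<one>\<^bsub>G\<^esub> = 1\<^sub>m n"
  proof (rule ext)
    fix v :: "int vec" assume v: "v \<in> carrier_vec n"
    have "\<phi> (?M \<one>\<^bsub>G\<^esub> *\<^sub>v v) = \<phi> v" using v \<phi>cl[OF v] by (simp add: M)
    then have "?M \<one>\<^bsub>G\<^esub> *\<^sub>v v = v"
      by (rule inj) (use Mc v in \<open>auto intro: mult_mat_vec_carrier\<close>)
    then show "?M \<one>\<^bsub>G\<^esub> *\<^sub>v v = 1\<^sub>m n *\<^sub>v v" using v by simp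
  qed (use Mc in auto)
  have "?M g \<in> Units (ring_mat TYPE(int) n ())" if g: "g \<in> carrier G" for g
  proof -
    have "?M (inv\<^bsub>G\<^esub> g) * ?M g = 1\<^sub>m n" "?M g * ?M (inv\<^bsub>G\<^esub> g) = 1\<^sub>m n"
      using mult[of g "inv\<^bsub>G\<^esub> g"] mult[of "inv\<^bsub>G\<^esub> g" g] g one by simp_all
    then show ?thesis using Mc by (auto simp: Units_def ring_mat_simps)
  qed
  then show "?M \<in> hom G (GLZ n)"
    using mult by (auto simp: hom_def GLZ_def units_of_def ring_mat_simps)
qed

end

theory Submission
  imports Defs "HOL-Algebra.Generated_Groups"
begin

text \<open>
  Let \<open>u \<noteq> 1\<close> have a finite conjugacy class \<open>C\<close>. If \<open>u\<close> has finite order, then Dietzmann's lemma shows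
  that \<open>C\<close> generates a finite normal subgroup. Otherwise we may assume that the subgroup \<open>FC\<^sub>G(K)\<close> is
  torsion-free. Some power \<open>u\<^sup>m\<close> commutes with the finite set \<open>C\<close>; conjugating, the powers \<open>c\<^sup>m\<close> with
  \<open>c \<in> C\<close> commute with each other, so they generate a normal, finitely generated, torsion-free Abelian
  subgroup, which is free. All its elements have finite conjugacy classes, so there are only finitely
  many possibilities for the columns of the matrices describing the action of \<open>G\<close>. Conversely, under
  (i) or (ii) every element of the given subgroup has a finite conjugacy class.
\<close>

section \<open>Finitely generated torsion-free Abelian groups are free\<close>

definition (in group) torsion_free :: bool where
  "torsion_free \<longleftrightarrow> (\<forall>x\<in>carrier G. \<forall>k::nat>0. x [^] k = \<one> \<longrightarrow> x = \<one>)"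

text \<open>In additive notation this is the integer linear combination of the family
  \<open>a\<close> with coefficients \<open>v\<close>. Indexing by \<open>I\<close> allows
  generators to coincide or to become trivial while they are being changed.\<close>

definition (in comm_group) power_prod :: "'i set \<Rightarrow> ('i \<Rightarrow> 'a) \<Rightarrow> ('i \<Rightarrow> int) \<Rightarrow> 'a" where
  "power_prod I a v = finprod G (\<lambda>i. a i [^] v i) I"

definition (in comm_group) spans :: "'i set \<Rightarrow> ('i \<Rightarrow> 'a) \<Rightarrow> bool" where
  "spans I a \<longleftrightarrow> a \<in> I \<rightarrow> carrier G \<and> (\<forall>x\<in>carrier G. \<exists>v. x = power_prod I a v)"

context comm_group
begin

lemma power_prod_closed [simp, intro]:
  "a \<in> I \<rightarrow> carrier G \<Longrightarrow> power_prod I a v \<in> carrier G"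
  unfolding power_prod_def by (auto intro!: finprod_closed)

lemma power_prod_cong:
  assumes "a \<in> I \<rightarrow> carrier G" "\<And>i. i \<in> I \<Longrightarrow> b i = a i" "\<And>i. i \<in> I \<Longrightarrow> v i = w i"
  shows "power_prod I b v = power_prod I a w"
  unfolding power_prod_def using assms by (intro finprod_cong') auto

lemma power_prod_insert:
  assumes "finite I" "i \<notin> I" "a \<in> insert i I \<rightarrow> carrier G"
  shows "power_prod (insert i I) a v = a i [^] v i \<otimes> power_prod I a v"
  unfolding power_prod_def using assms by (intro finprod_insert) auto

lemma power_prod_zero: "power_prod I a (\<lambda>_. 0) = \<one>"
  unfolding power_prod_def by simp

lemma power_prod_add:
  assumes "a \<in> I \<rightarrow> carrier G"
  shows "power_prod I a (\<lambda>i. v i + w i) = power_prod I a v \<otimes> power_prod I a w"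
proof -
  have "power_prod I a (\<lambda>i. v i + w i) = finprod G (\<lambda>i. a i [^] v i \<otimes> a i [^] w i) I"
    unfolding power_prod_def using assms by (intro finprod_cong') (auto simp: int_pow_mult Pi_iff)
  also have "\<dots> = power_prod I a v \<otimes> power_prod I a w"
    unfolding power_prod_def using assms by (intro finprod_multf) auto
  finally show ?thesis .
qed

lemma power_prod_uminus:
  assumes "a \<in> I \<rightarrow> carrier G"
  shows "power_prod I a (\<lambda>i. - v i) = inv power_prod I a v"
proof (rule inv_equality[symmetric])
  show "power_prod I a (\<lambda>i. - v i) \<otimes> power_prod I a v = \<one>"
    using power_prod_add[OF assms, of "\<lambda>i. - v i" v] by (simp add: power_prod_zero)
qed (use assms in auto)

text \<open>An elementary change of generators: the extra factor \<open>a i [^] (s * v j)\<close>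
  brought in by the new \<open>j\<close>-th generator is cancelled by lowering the exponent of
  \<open>a i\<close> by \<open>s * v j\<close>.\<close>

lemma power_prod_transvection:
  assumes "finite I" "i \<in> I" "j \<in> I" "i \<noteq> j" and a: "a \<in> I \<rightarrow> carrier G"
  shows "power_prod I (a(j := a j \<otimes> a i [^] s)) (v(i := v i - s * v j)) = power_prod I a v"
proof -
  define J where "J = I - {i, j}"
  have J: "finite J" "i \<notin> J" "j \<notin> J" and I: "I = insert i (insert j J)"
    using assms by (auto simp: J_def)
  have c: "a i \<in> carrier G" "a j \<in> carrier G" and aJ: "a \<in> J \<rightarrow> carrier G" using a I by auto
  let ?b = "a(j := a j \<otimes> a i [^] s)" and ?w = "v(i := v i - s * v j)"
  have b: "?b \<in> insert i (insert j J) \<rightarrow> carrier G" using c aJ by auto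
  have P: "power_prod J a v \<in> carrier G" using aJ by simp
  have "power_prod J ?b ?w = power_prod J a v"
    by (rule power_prod_cong[OF aJ]) (use J in auto)
  then have "power_prod I ?b ?w
      = a i [^] (v i - s * v j) \<otimes> ((a j \<otimes> a i [^] s) [^] v j \<otimes> power_prod J a v)"
    unfolding I using J b \<open>i \<noteq> j\<close> by (subst power_prod_insert; simp add: power_prod_insert)
  also have "(a j \<otimes> a i [^] s) [^] v j = a j [^] v j \<otimes> a i [^] (s * v j)"
    using c by (simp add: int_pow_distrib int_pow_pow)
  also have "a i [^] (v i - s * v j) \<otimes> (a j [^] v j \<otimes> a i [^] (s * v j) \<otimes> power_prod J a v)
      = (a i [^] (v i - s * v j) \<otimes> a i [^] (s * v j)) \<otimes> (a j [^] v j \<otimes> power_prod J a v)"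
    using c P by (simp add: m_ac)
  also have "a i [^] (v i - s * v j) \<otimes> a i [^] (s * v j) = a i [^] v i"
    using c by (simp flip: int_pow_mult)
  also have "a i [^] v i \<otimes> (a j [^] v j \<otimes> power_prod J a v) = power_prod I a v"
    unfolding I using J c aJ \<open>i \<noteq> j\<close> by (simp add: power_prod_insert)
  finally show ?thesis .
qed

text \<open>Each exponent vector for the old family can be rewritten as one for the new family with
  the same product, so no element is lost.\<close>

lemma spans_transvection:
  assumes "finite I" "i \<in> I" "j \<in> I" "i \<noteq> j" "spans I a"
  shows "spans I (a(j := a j \<otimes> a i [^] (s::int)))"
proof -
  have a: "a \<in> I \<rightarrow> carrier G" using assms by (simp add: spans_def)
  then have "a(j := a j \<otimes> a i [^] s) \<in> I \<rightarrow> carrier G" using assms by (auto simp: Pi_iff)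
  moreover have "\<exists>w. x = power_prod I (a(j := a j \<otimes> a i [^] s)) w" if "x \<in> carrier G" for x
    using assms that power_prod_transvection[OF assms(1-4) a] by (metis spans_def)
  ultimately show ?thesis by (simp add: spans_def)
qed

lemma spans_remove:
  assumes "finite I" "i \<in> I" "a i = \<one>" "spans I a"
  shows "spans (I - {i}) a"
proof -
  have a: "a \<in> I \<rightarrow> carrier G" using assms by (simp add: spans_def)
  have "power_prod I a v = power_prod (I - {i}) a v" for v
  proof -
    have "power_prod (insert i (I - {i})) a v = a i [^] v i \<otimes> power_prod (I - {i}) a v"
      using assms a by (intro power_prod_insert) auto
    moreover have "power_prod (I - {i}) a v \<in> carrier G" using a by auto
    ultimately show ?thesis using assms by (simp add: insert_absorb)
  qed
  then show ?thesis using assms(4) unfolding spans_def by auto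
qed

text \<open>Euclid's algorithm on the exponents of the relation: a transvection of the generators makes
  the exponents smaller, and a relation with a single non-zero exponent exhibits a trivial generator.\<close>

lemma spans_smaller:
  assumes "torsion_free"
    and "finite I" "spans I a" "power_prod I a v = \<one>" "\<exists>i\<in>I. v i \<noteq> 0"
  shows "\<exists>i\<in>I. \<exists>b. spans (I - {i}) b"
  using assms(3-5)
proof (induction "\<Sum>i\<in>I. nat \<bar>v i\<bar>" arbitrary: a v rule: less_induct)
  case less
  obtain j where j: "j \<in> I" "v j \<noteq> 0" using less.prems by auto
  have a: "a \<in> I \<rightarrow> carrier G" using less.prems by (simp add: spans_def)
  show ?case
  proof (cases "\<exists>i\<in>I. i \<noteq> j \<and> v i \<noteq> 0")
    case False
    have "power_prod (I - {j}) a v = power_prod (I - {j}) a (\<lambda>_. 0)"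
      by (rule power_prod_cong) (use a False in auto)
    then have "power_prod (insert j (I - {j})) a v = a j [^] v j"
      using a j \<open>finite I\<close> by (subst power_prod_insert) (auto simp: power_prod_zero Pi_iff)
    then have "a j [^] v j = \<one>" using less.prems j by (simp add: insert_absorb)
    moreover have aj: "a j \<in> carrier G" using a j by auto
    \<comment> \<open>\<open>torsion_free\<close> speaks of natural exponents, so a negative
      exponent is first replaced by its absolute value.\<close>
    ultimately have "a j [^] nat \<bar>v j\<bar> = \<one>"
      by (cases "v j \<ge> 0") (simp_all add: abs_if int_pow_neg flip: int_pow_int)
    then have "a j = \<one>" using j aj \<open>torsion_free\<close> by (metis torsion_free_def zero_less_abs_iff zero_less_nat_eq)
    then show ?thesis using spans_remove[OF \<open>finite I\<close>] j less.prems by blast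
  next
    case True
    then obtain k where "k \<in> I" "k \<noteq> j" "v k \<noteq> 0" by auto
    then obtain p q where pq: "p \<in> I" "q \<in> I" "p \<noteq> q" "v p \<noteq> 0" "v q \<noteq> 0" "\<bar>v q\<bar> \<le> \<bar>v p\<bar>"
      using j by (metis linear)
    \<comment> \<open>With this sign, \<open>v p - s * v q\<close> has absolute value
      \<open>abs (v p) - abs (v q)\<close>, a strict decrease because \<open>v q\<close> is
      non-zero.\<close>
    define s where "s = sgn (v p) * sgn (v q)"
    let ?b = "a(q := a q \<otimes> a p [^] s)" and ?w = "v(p := v p - s * v q)"
    have "\<bar>v p - s * v q\<bar> < \<bar>v p\<bar>"
      using pq unfolding s_def by (auto simp: sgn_if split: if_splits)
    then have "(\<Sum>i\<in>I. nat \<bar>?w i\<bar>) < (\<Sum>i\<in>I. nat \<bar>v i\<bar>)"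
      using pq \<open>finite I\<close> by (intro sum_strict_mono_ex1) auto
    moreover have "spans I ?b" using spans_transvection[OF \<open>finite I\<close> pq(1-3)] less.prems by blast
    moreover have "power_prod I ?b ?w = \<one>"
      using power_prod_transvection[OF \<open>finite I\<close> pq(1-3) a] less.prems by simp
    \<comment> \<open>The exponent at \<open>q\<close> is unchanged, so the new relation is still
      non-trivial.\<close>
    moreover have "\<exists>i\<in>I. ?w i \<noteq> 0" using pq by auto
    ultimately show ?thesis by (rule less.hyps)
  qed
qed

text \<open>Induction on the number of generators: a non-trivial relation allows one of them to be
  discarded, and without such a relation evaluating exponent vectors is an isomorphism. Rank 0 is
  possible, for the trivial group.\<close>

lemma spans_imp_free:
  assumes "torsion_free"
    and "finite I" "spans I a"
  shows "\<exists>n \<phi>. \<phi> \<in> iso (Zn n) G"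
  using assms(2,3)
proof (induction "card I" arbitrary: I a rule: less_induct)
  case less
  have a: "a \<in> I \<rightarrow> carrier G" using less.prems by (simp add: spans_def)
  show ?case
  proof (cases "\<exists>v. power_prod I a v = \<one> \<and> (\<exists>i\<in>I. v i \<noteq> 0)")
    case True
    then obtain i b where "i \<in> I" "spans (I - {i}) b"
      using spans_smaller[OF \<open>torsion_free\<close> less.prems] by blast
    moreover have "card (I - {i}) < card I" using \<open>i \<in> I\<close> less.prems by (intro card_Diff1_less)
    ultimately show ?thesis using less.hyps less.prems by blast
  next
    case indep: False
    \<comment> \<open>The enumeration \<open>h\<close> turns an integer vector into a family of
      exponents indexed by \<open>I\<close>.\<close>
    obtain h where h: "bij_betw h I {..<card I}"
      using ex_bij_betw_finite_nat[OF less.prems(1)] by (auto simp: atLeast0LessThan)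
    let ?n = "card I" and ?\<phi> = "\<lambda>v. power_prod I a (\<lambda>i. v $ h i)"
    have h_less: "h i < ?n" if "i \<in> I" for i using h that by (auto dest: bij_betwE)
    have "?\<phi> \<in> iso (Zn ?n) G"
    proof (rule isoI)
      show "?\<phi> \<in> hom (Zn ?n) G"
      proof (rule homI)
        fix v w :: "int vec" assume "v \<in> carrier (Zn ?n)" "w \<in> carrier (Zn ?n)"
        then have "power_prod I a (\<lambda>i. (v + w) $ h i) = power_prod I a (\<lambda>i. v $ h i + w $ h i)"
          by (intro power_prod_cong[OF a]) (auto simp: monoid_vec_simps h_less)
        then show "?\<phi> (v \<otimes>\<^bsub>Zn ?n\<^esub> w) = ?\<phi> v \<otimes> ?\<phi> w"
          by (simp add: power_prod_add[OF a] monoid_vec_simps)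
      qed (use a in auto)
      have "inj_on ?\<phi> (carrier_vec ?n)"
      proof (rule inj_onI)
        fix v w :: "int vec" assume vw: "v \<in> carrier_vec ?n" "w \<in> carrier_vec ?n" "?\<phi> v = ?\<phi> w"
        \<comment> \<open>Two vectors with the same value differ by a relation, and every relation
          is trivial here.\<close>
        have "power_prod I a (\<lambda>i. v $ h i + - w $ h i) = ?\<phi> v \<otimes> inv ?\<phi> w"
          using a by (simp only: power_prod_add power_prod_uminus)
        also have "\<dots> = \<one>" using vw a by simp
        finally have "v $ h i + - w $ h i = 0" if "i \<in> I" for i using indep that by blast
        moreover have "\<exists>i\<in>I. k = h i" if "k < ?n" for k
          using h that by (auto simp: bij_betw_def)
        ultimately show "v = w" using vw by (intro eq_vecI) fastforce+
      qed
      moreover have "?\<phi> ` carrier_vec ?n = carrier G"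
      proof (intro equalityI subsetI)
        fix x assume "x \<in> carrier G"
        then obtain u where u: "x = power_prod I a u" using less.prems by (auto simp: spans_def)
        have "?\<phi> (vec ?n (\<lambda>k. u (inv_into I h k))) = power_prod I a u"
          using h by (intro power_prod_cong[OF a]) (auto simp: h_less bij_betw_def)
        then show "x \<in> ?\<phi> ` carrier_vec ?n" using u by (metis image_eqI vec_carrier)
      qed (use a in auto)
      ultimately show "bij_betw ?\<phi> (carrier (Zn ?n)) (carrier G)"
        by (simp add: bij_betw_def monoid_vec_simps)
    qed
    then show ?thesis by blast
  qed
qed

text \<open>The set \<open>B\<close> indexes itself through \<open>id\<close>. A generator or its
  inverse has a single non-zero exponent, 1 or -1, and products correspond to sums of
  exponents.\<close>

lemma spans_generate:
  assumes "finite B" "B \<subseteq> carrier G" "generate G B = carrier G"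
  shows "spans B id"
proof -
  have B: "id \<in> B \<rightarrow> carrier G" using assms by auto
  have "\<exists>v. x = power_prod B id v" if "x \<in> generate G B" for x
    using that
  proof (induction rule: generate.induct)
    case one
    show ?case using power_prod_zero by metis
  next
    case (incl b)
    have "power_prod (insert b (B - {b})) id (\<lambda>c. if c = b then 1 else 0) = b"
    proof -
      have "power_prod (B - {b}) id (\<lambda>c. if c = b then 1 else 0) = power_prod (B - {b}) id (\<lambda>_. 0)"
        by (rule power_prod_cong) (use assms in auto)
      then show ?thesis using assms incl by (subst power_prod_insert) (auto simp: power_prod_zero)
    qed
    then show ?case using incl by (metis insert_Diff)
  next
    case (inv b)
    have "power_prod (insert b (B - {b})) id (\<lambda>c. if c = b then - 1 else 0) = inv b"
    proof -
      have "power_prod (B - {b}) id (\<lambda>c. if c = b then - 1 else 0) = power_prod (B - {b}) id (\<lambda>_. 0)"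
        by (rule power_prod_cong) (use assms in auto)
      then show ?thesis using assms inv 
        by (subst power_prod_insert) (auto simp: power_prod_zero int_pow_neg)
    qed
    then show ?case using inv by (metis insert_Diff)
  next
    case (eng x y)
    then show ?case using power_prod_add[OF B] by metis
  qed
  then show ?thesis using assms B by (simp add: spans_def)
qed

theorem fin_gen_torsion_free_imp_free:
  assumes "torsion_free"
    and "finite B" "B \<subseteq> carrier G" "generate G B = carrier G"
  shows "\<exists>n \<phi>. \<phi> \<in> iso (Zn n) G"
  using spans_imp_free[OF assms(1,2) spans_generate[OF assms(2-4)]] .

end

section \<open>Conjugation, conjugacy classes and the FC-subgroup\<close>

context group
begin

lemma conj_mult:
  assumes "g \<in> carrier G" "x \<in> carrier G" "y \<in> carrier G"
  shows "g \<otimes> (x \<otimes> y) \<otimes> inv g = (g \<otimes> x \<otimes> inv g) \<otimes> (g \<otimes> y \<otimes> inv g)"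
  using assms by (simp add: m_assoc inv_solve_left' inv_solve_left)

lemma conj_conj:
  assumes "g \<in> carrier G" "h \<in> carrier G" "x \<in> carrier G"
  shows "g \<otimes> (h \<otimes> x \<otimes> inv h) \<otimes> inv g = (g \<otimes> h) \<otimes> x \<otimes> inv (g \<otimes> h)"
  using assms by (simp add: m_assoc inv_mult_group)

lemma conj_pow:
  assumes "g \<in> carrier G" "x \<in> carrier G"
  shows "g \<otimes> x [^] (k::nat) \<otimes> inv g = (g \<otimes> x \<otimes> inv g) [^] k"
  using assms by (induction k) (simp_all add: conj_mult)

lemma conj_inv:
  assumes "g \<in> carrier G" "x \<in> carrier G"
  shows "g \<otimes> inv x \<otimes> inv g = inv (g \<otimes> x \<otimes> inv g)"
  using assms by (simp add: m_assoc inv_mult_group)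

lemma conj_inject:
  assumes "g \<in> carrier G" "x \<in> carrier G" "y \<in> carrier G" "g \<otimes> x \<otimes> inv g = g \<otimes> y \<otimes> inv g"
  shows "x = y"
  using assms by simp

lemma conj_eq_iff_commute:
  assumes "g \<in> carrier G" "x \<in> carrier G"
  shows "g \<otimes> x \<otimes> inv g = x \<longleftrightarrow> g \<otimes> x = x \<otimes> g"
  using assms by (simp add: inv_solve_right')

lemma conjugacy_class_eq:
  "u \<in> carrier G \<Longrightarrow> conjugacy_class G u = (\<lambda>g. g \<otimes> u \<otimes> inv g) ` carrier G"
  by (auto simp: conjugacy_class_def orbit_def conj_action_def)

lemma conjugacy_class_conj:
  assumes "u \<in> carrier G" "c \<in> conjugacy_class G u" "g \<in> carrier G"
  shows "g \<otimes> c \<otimes> inv g \<in> conjugacy_class G u"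
  using assms by (auto simp: conjugacy_class_eq conj_conj)

lemma conjugacy_class_self: "u \<in> carrier G \<Longrightarrow> u \<in> conjugacy_class G u"
  unfolding conjugacy_class_eq by (rule image_eqI[of _ _ \<one>]) simp_all

lemma conjugacy_class_subset_carrier: "u \<in> carrier G \<Longrightarrow> conjugacy_class G u \<subseteq> carrier G"
  by (auto simp: conjugacy_class_eq)

lemma conjugacy_class_subset_normal:
  assumes "N \<lhd> G" "u \<in> N"
  shows "conjugacy_class G u \<subseteq> N"
proof -
  have "u \<in> carrier G" using assms normal_imp_subgroup subgroup.mem_carrier by fast
  then show ?thesis
    using assms normal.inv_op_closed2[OF assms(1)] by (auto simp: conjugacy_class_eq)
qed

text \<open>The class of an inverse consists of the inverses of the class, and the class of a
  product lies in the set of products of members of the two classes; both are therefore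
  finite.\<close>

lemma FC_subgroup:
  assumes "K \<lhd> G"
  shows "subgroup (FC G K) G"
proof -
  interpret K: subgroup K G using assms by (rule normal_imp_subgroup)
  show ?thesis
  proof (rule subgroupI)
    have "conjugacy_class G \<one> = {\<one>}" by (auto simp: conjugacy_class_eq)
    then have "\<one> \<in> FC G K" by (simp add: FC_def)
    then show "FC G K \<noteq> {}" by blast
  next
    fix x assume x: "x \<in> FC G K"
    then have xK: "x \<in> K" "x \<in> carrier G" by (auto simp: FC_def)
    have "conjugacy_class G (inv x) = (\<lambda>y. inv y) ` conjugacy_class G x"
      using xK by (simp add: conjugacy_class_eq image_image conj_inv)
    then show "inv x \<in> FC G K" using x xK by (simp add: FC_def)
  next
    fix x y assume x: "x \<in> FC G K" and y: "y \<in> FC G K"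
    then have K: "x \<in> K" "x \<in> carrier G" "y \<in> K" "y \<in> carrier G" by (auto simp: FC_def)
    have "conjugacy_class G (x \<otimes> y)
        \<subseteq> (\<lambda>(a, b). a \<otimes> b) ` (conjugacy_class G x \<times> conjugacy_class G y)"
      using K by (auto simp: conjugacy_class_eq conj_mult)
    then show "x \<otimes> y \<in> FC G K" using x y K by (auto simp: FC_def intro: finite_subset)
  qed (auto simp: FC_def)
qed

text \<open>A conjugate of a conjugate of \<open>u\<close> is a conjugate of \<open>u\<close>, so
  the class of each conjugate is again finite.\<close>

lemma conjugacy_class_subset_FC:
  assumes "K \<lhd> G" "u \<in> FC G K"
  shows "conjugacy_class G u \<subseteq> FC G K"
proof
  fix c assume c: "c \<in> conjugacy_class G u"
  have u: "u \<in> K" "u \<in> carrier G" "finite (conjugacy_class G u)"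
    using assms normal_imp_subgroup[OF assms(1)] by (auto simp: FC_def subgroup.mem_carrier)
  have "c \<in> carrier G" using conjugacy_class_subset_carrier[OF u(2)] c by blast
  then have "conjugacy_class G c \<subseteq> conjugacy_class G u"
    using conjugacy_class_conj[OF u(2) c] by (simp add: conjugacy_class_eq[of c] image_subset_iff)
  then show "c \<in> FC G K"
    using u c conjugacy_class_subset_normal[OF assms(1)] by (auto simp: FC_def intro: finite_subset)
qed

section \<open>Dietzmann's lemma\<close>

lemma foldr_mult_closed: "set w \<subseteq> carrier G \<Longrightarrow> foldr (\<otimes>) w \<one> \<in> carrier G"
  by (induction w) auto

text \<open>Generators of finite order have their inverses among their natural powers, so words
  without inverse letters suffice.\<close>

lemma generate_torsion_eq_words:
  assumes "C \<subseteq> carrier G" "\<And>c. c \<in> C \<Longrightarrow> \<exists>n::nat>0. c [^] n = \<one>"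
    and "x \<in> generate G C"
  shows "\<exists>w. set w \<subseteq> C \<and> x = foldr (\<otimes>) w \<one>"
  using assms(3)
proof induction
  case one
  show ?case by (rule exI[of _ "[]"]) simp
next
  case (incl c)
  then show ?case using assms(1) by (intro exI[of _ "[c]"]) auto
next
  case (inv c)
  then obtain n :: nat where n: "0 < n" "c [^] n = \<one>" using assms(2) by blast
  have c: "c \<in> carrier G" using inv assms(1) by auto
  have "foldr (\<otimes>) (replicate k c) \<one> = c [^] k" for k
    using c nat_pow_Suc2[OF c] by (induction k) simp_all
  moreover have "inv c = c [^] (n - 1)"
    using n c nat_pow_Suc[of c "n - 1"] by (intro inv_equality) simp_all
  ultimately show ?case using inv by (intro exI[of _ "replicate (n - 1) c"]) auto
next
  case (eng x y)
  then obtain v w where "set v \<subseteq> C" "x = foldr (\<otimes>) v \<one>" "set w \<subseteq> C" "y = foldr (\<otimes>) w \<one>" by blast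
  moreover have "foldr (\<otimes>) (v @ w) \<one> = foldr (\<otimes>) v \<one> \<otimes> foldr (\<otimes>) w \<one>"
    if "set v \<subseteq> carrier G" "set w \<subseteq> carrier G" for v w
    using that by (induction v) (simp_all add: foldr_mult_closed m_assoc)
  ultimately show ?case using assms(1) by (intro exI[of _ "v @ w"]) auto
qed

text \<open>Moving a letter \<open>c\<close> to the front conjugates the other letters by \<open>c\<close>, so no new letters arise. A
  word in which some letter occurs at least as often as the exponent of that letter can thus be
  shortened, which bounds the length of the words needed.\<close>

lemma collect_letter:
  assumes C: "C \<subseteq> carrier G" "\<And>g x. g \<in> carrier G \<Longrightarrow> x \<in> C \<Longrightarrow> g \<otimes> x \<otimes> inv g \<in> C"
    and "c \<in> C" "set w \<subseteq> C"
  shows "\<exists>w'. set w' \<subseteq> C \<and> length w = count_list w c + length w' \<and>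
      foldr (\<otimes>) w \<one> = c [^] count_list w c \<otimes> foldr (\<otimes>) w' \<one>"
  using assms(4)
proof (induction w)
  case Nil
  show ?case by (rule exI[of _ "[]"]) simp
next
  case (Cons a w)
  then obtain w' where w': "set w' \<subseteq> C" "length w = count_list w c + length w'"
      "foldr (\<otimes>) w \<one> = c [^] count_list w c \<otimes> foldr (\<otimes>) w' \<one>" by auto
  have cl: "a \<in> C" "a \<in> carrier G" "c \<in> carrier G" "foldr (\<otimes>) w' \<one> \<in> carrier G"
    using Cons.prems C(1) w' assms(3) by (auto intro!: foldr_mult_closed)
  show ?case
  proof (cases "a = c")
    case True
    then show ?thesis using w' cl nat_pow_Suc2[OF cl(3), of "count_list w c"]
      by (intro exI[of _ w']) (simp add: m_assoc[symmetric])
  next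
    case False
    let ?p = "c [^] count_list w c"
    have "inv ?p \<otimes> a \<otimes> inv (inv ?p) \<in> C" using cl by (intro C(2)) auto
    then have "inv ?p \<otimes> a \<otimes> ?p \<in> C" using cl by simp
    moreover have "a \<otimes> (?p \<otimes> foldr (\<otimes>) w' \<one>) = ?p \<otimes> ((inv ?p \<otimes> a \<otimes> ?p) \<otimes> foldr (\<otimes>) w' \<one>)"
      using cl by (simp add: m_assoc[symmetric])
    ultimately show ?thesis using False w' cl
      by (intro exI[of _ "(inv ?p \<otimes> a \<otimes> ?p) # w'"]) simp
  qed
qed

text \<open>Dietzmann's lemma. Each element is the value of a word of bounded length over the finite
  alphabet \<open>C\<close>, and there are only finitely many such words.\<close>

theorem finite_generate_torsion:
  assumes "finite C" and C: "C \<subseteq> carrier G"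
    and conj: "\<And>g x. g \<in> carrier G \<Longrightarrow> x \<in> C \<Longrightarrow> g \<otimes> x \<otimes> inv g \<in> C"
    and torsion: "\<And>c. c \<in> C \<Longrightarrow> \<exists>n::nat>0. c [^] n = \<one>"
  shows "finite (generate G C)"
proof -
  obtain e :: "'a \<Rightarrow> nat" where e: "\<And>c. c \<in> C \<Longrightarrow> 0 < e c \<and> c [^] e c = \<one>"
  proof -
    have "\<forall>c\<in>C. \<exists>n::nat. 0 < n \<and> c [^] n = \<one>" using torsion by blast
    then show ?thesis using that by (auto dest!: bchoice)
  qed
  let ?W = "{w. set w \<subseteq> C \<and> length w \<le> (\<Sum>c\<in>C. e c)}"
  have "\<exists>w'. w' \<in> ?W \<and> foldr (\<otimes>) w' \<one> = foldr (\<otimes>) w \<one>" if "set w \<subseteq> C" for w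
    using that
  proof (induction w rule: length_induct)
    case (1 w)
    show ?case
    proof (cases "\<exists>c\<in>C. e c \<le> count_list w c")
      \<comment> \<open>Every letter occurs fewer than \<open>e c\<close> times, and the length is
        the sum of these counts.\<close>
      case False
      then have "length w \<le> (\<Sum>c\<in>C. e c)"
        using 1(2) \<open>finite C\<close> by (auto simp flip: sum_count_set intro!: sum_mono)
      then show ?thesis using 1(2) by blast
    next
      case True
      then obtain c where c: "c \<in> C" "e c \<le> count_list w c" by blast
      then obtain w' where w': "set w' \<subseteq> C" "length w = count_list w c + length w'"
          "foldr (\<otimes>) w \<one> = c [^] count_list w c \<otimes> foldr (\<otimes>) w' \<one>"
        using collect_letter[OF C conj _ 1(2)] by blast
      \<comment> \<open>After the copies of \<open>c\<close> are collected in front,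
        \<open>e c\<close> of them are deleted; their product is trivial and \<open>e c\<close> is
        positive, so the word gets shorter with the same value.\<close>
      let ?v = "replicate (count_list w c - e c) c @ w'"
      have cl: "c \<in> carrier G" "foldr (\<otimes>) w' \<one> \<in> carrier G"
        using c C w' by (auto intro!: foldr_mult_closed)
      have "foldr (\<otimes>) (replicate k c @ w') \<one> = c [^] k \<otimes> foldr (\<otimes>) w' \<one>" for k
      proof (induction k)
        case (Suc k)
        then show ?case using cl nat_pow_Suc2[OF cl(1), of k] by (simp add: m_assoc[symmetric])
      qed (use cl in simp)
      moreover have "c [^] count_list w c = c [^] (count_list w c - e c)"
        using c e[of c] cl nat_pow_mult[of c "e c" "count_list w c - e c"] by simp
      ultimately have "foldr (\<otimes>) ?v \<one> = foldr (\<otimes>) w \<one>" using w' by simp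
      moreover have "set ?v \<subseteq> C" using c w' by auto
      moreover have "length ?v < length w" using e[of c] c w' by simp
      ultimately show ?thesis using 1(1) by metis
    qed
  qed
  then have "generate G C \<subseteq> (\<lambda>w. foldr (\<otimes>) w \<one>) ` ?W"
    using generate_torsion_eq_words[OF C torsion] by (fastforce simp: image_iff)
  moreover have "finite ?W" using \<open>finite C\<close> by (rule finite_lists_length_le)
  ultimately show ?thesis by (meson finite_surj)
qed

section \<open>Commuting generators and commuting powers\<close>

text \<open>Centralizers are subgroups, so an element commuting with all of \<open>B\<close>
  commutes with everything that \<open>B\<close> generates. This is used twice: first for elements
  of \<open>B\<close>, then for elements of the generated subgroup.\<close>

lemma comm_group_generate:
  assumes B: "B \<subseteq> carrier G" and comm: "\<And>x y. x \<in> B \<Longrightarrow> y \<in> B \<Longrightarrow> x \<otimes> y = y \<otimes> x"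
  shows "comm_group (G\<lparr>carrier := generate G B\<rparr>)"
proof -
  have sub: "subgroup {y \<in> carrier G. x \<otimes> y = y \<otimes> x} G" if x: "x \<in> carrier G" for x
  proof (rule subgroupI)
    fix y assume "y \<in> {y \<in> carrier G. x \<otimes> y = y \<otimes> x}"
    then show "inv y \<in> {y \<in> carrier G. x \<otimes> y = y \<otimes> x}"
      using x conj_inv[of x y] conj_eq_iff_commute[of x y] conj_eq_iff_commute[of x "inv y"] by simp
  next
    fix y z assume "y \<in> {y \<in> carrier G. x \<otimes> y = y \<otimes> x}" "z \<in> {y \<in> carrier G. x \<otimes> y = y \<otimes> x}"
    then show "y \<otimes> z \<in> {y \<in> carrier G. x \<otimes> y = y \<otimes> x}"
      using x by simp (metis m_assoc)
  qed (use x in auto)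
  have step: "x \<otimes> y = y \<otimes> x"
    if "x \<in> carrier G" "\<And>z. z \<in> B \<Longrightarrow> x \<otimes> z = z \<otimes> x" "y \<in> generate G B" for x y
    using generate_subgroup_incl[OF _ sub[OF that(1)], of B] that B by blast
  have "x \<otimes> y = y \<otimes> x" if "x \<in> generate G B" "y \<in> generate G B" for x y
    using that B comm step by (metis generate_in_carrier subsetD)
  then show ?thesis
    using subgroup.subgroup_is_group[OF generate_is_subgroup[OF B] is_group]
    by (intro group.group_comm_groupI) auto
qed

text \<open>Pigeonhole: the conjugates of \<open>c\<close> by the powers of \<open>u\<close> lie in
  a finite class, so two of them coincide, and the quotient of the two powers centralizes
  \<open>c\<close>.\<close>

lemma pow_commute_finite_class:
  assumes "u \<in> carrier G" "c \<in> carrier G" "finite (conjugacy_class G c)"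
  shows "\<exists>m::nat>0. u [^] m \<otimes> c = c \<otimes> u [^] m"
proof -
  let ?f = "\<lambda>i::nat. u [^] i \<otimes> c \<otimes> inv (u [^] i)"
  have "range ?f \<subseteq> conjugacy_class G c" using assms by (auto simp: conjugacy_class_eq)
  then have "\<not> inj ?f" using assms(3) by (meson finite_imageD finite_subset infinite_UNIV_nat)
  then obtain i j where "i < j" and ij: "?f i = ?f j" unfolding inj_def by (metis linorder_neqE_nat)
  have "u [^] j = u [^] i \<otimes> u [^] (j - i)"
    using assms \<open>i < j\<close> by (simp add: nat_pow_mult)
  then have "?f j = u [^] i \<otimes> (u [^] (j - i) \<otimes> c \<otimes> inv (u [^] (j - i))) \<otimes> inv (u [^] i)"
    using assms by (simp only: conj_conj nat_pow_closed)
  \<comment> \<open>Conjugation by \<open>u [^] i\<close> is injective and is cancelled from both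
    sides of \<open>?f i = ?f j\<close>.\<close>
  then have "u [^] (j - i) \<otimes> c \<otimes> inv (u [^] (j - i)) = c"
    by (intro conj_inject[OF _ _ _ trans[OF sym sym[OF ij]]]) (use assms in auto)
  then have "u [^] (j - i) \<otimes> c = c \<otimes> u [^] (j - i)"
    using assms conj_eq_iff_commute by blast
  then show ?thesis using \<open>i < j\<close> by (intro exI[of _ "j - i"]) simp
qed

lemma pow_commute_finite_classes:
  assumes "u \<in> carrier G" "finite C" "C \<subseteq> carrier G" "\<And>c. c \<in> C \<Longrightarrow> finite (conjugacy_class G c)"
  shows "\<exists>m::nat>0. \<forall>c\<in>C. u [^] m \<otimes> c = c \<otimes> u [^] m"
proof -
  obtain m :: "'a \<Rightarrow> nat" where m: "\<And>c. c \<in> C \<Longrightarrow> 0 < m c \<and> u [^] m c \<otimes> c = c \<otimes> u [^] m c"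
  proof -
    have "\<forall>c\<in>C. \<exists>m::nat. 0 < m \<and> u [^] m \<otimes> c = c \<otimes> u [^] m"
      using pow_commute_finite_class assms by blast
    then show ?thesis using that by (auto dest!: bchoice)
  qed
  \<comment> \<open>The product of the individual exponents is a common multiple of them, hence
    works for every \<open>c\<close> at once.\<close>
  have "u [^] (\<Prod>c\<in>C. m c) \<otimes> c = c \<otimes> u [^] (\<Prod>c\<in>C. m c)" if c: "c \<in> C" for c
  proof -
    obtain k where "(\<Prod>c\<in>C. m c) = m c * k"
      using dvd_prodI[OF assms(2) c, of m] unfolding dvd_def by blast
    then have "u [^] (\<Prod>c\<in>C. m c) = (u [^] m c) [^] k" using assms by (simp add: nat_pow_pow)
    then show ?thesis using m[OF c] assms c by (auto intro!: group_commutes_pow)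
  qed
  moreover have "0 < (\<Prod>c\<in>C. m c)" using m by (simp add: prod_pos)
  ultimately show ?thesis by blast
qed

end

section \<open>Finite matrix image versus finite conjugacy classes\<close>

text \<open>Column \<open>j\<close> of each matrix holds the coordinates of a conjugate of the
  \<open>j\<close>-th basis element, so all columns come from the finite set
  \<open>?S\<close>.\<close>

lemma (in group) finite_induced_hom_image:
  assumes A: "A \<lhd> G" and \<phi>: "\<phi> \<in> iso (Zn n) (G\<lparr>carrier := A\<rparr>)"
    and fin: "\<And>a. a \<in> A \<Longrightarrow> finite (conjugacy_class G a)"
  shows "finite (induced_hom G A n \<phi> ` carrier G)"
proof -
  have \<phi>A: "\<phi> (unit_vec n j) \<in> A" for j
    using \<phi> by (auto simp: iso_def hom_def monoid_vec_simps)
  have AG: "A \<subseteq> carrier G" using A by (simp add: normal_imp_subgroup subgroup.subset)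
  let ?\<psi> = "inv_into (carrier_vec n) \<phi>"
  let ?S = "\<Union>j<n. ?\<psi> ` conjugacy_class G (\<phi> (unit_vec n j))"
  have "induced_hom G A n \<phi> g \<in> mat_of_cols n ` {l. set l \<subseteq> ?S \<and> length l = n}"
    if g: "g \<in> carrier G" for g
  proof -
    have "conj_action G A g (\<phi> (unit_vec n j)) \<in> conjugacy_class G (\<phi> (unit_vec n j))" for j
      using g \<phi>A[of j] AG by (auto simp: conj_action_def conjugacy_class_eq subset_iff)
    then show ?thesis unfolding induced_hom_def aut_matrix_def by (intro imageI) auto
  qed
  moreover have "finite ?S" using fin \<phi>A by auto
  then have "finite {l. set l \<subseteq> ?S \<and> length l = n}" by (rule finite_lists_length_eq)
  ultimately show ?thesis by (meson finite_imageI finite_subset image_subsetI)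
qed

text \<open>The conjugate of \<open>\<phi> v\<close> by \<open>g\<close> depends only on the matrix
  of \<open>g\<close>, so finitely many matrices give finitely many conjugates.\<close>

lemma (in group) finite_class_of_finite_image:
  assumes A: "A \<lhd> G" and \<phi>: "\<phi> \<in> iso (Zn n) (G\<lparr>carrier := A\<rparr>)"
    and fin: "finite (induced_hom G A n \<phi> ` carrier G)" and a: "a \<in> A"
  shows "finite (conjugacy_class G a)"
proof -
  obtain v where v: "v \<in> carrier_vec n" "a = \<phi> v"
    using \<phi> a by (auto simp: iso_def bij_betw_def monoid_vec_simps)
  have "a \<in> carrier G" using A a normal_imp_subgroup subgroup.mem_carrier by fast
  then have "conjugacy_class G a = (\<lambda>M. \<phi> (M *\<^sub>v v)) ` induced_hom G A n \<phi> ` carrier G"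
    using induced_hom_in_hom(2)[OF A \<phi> _ v(1)] v(2)
    by (simp add: conjugacy_class_eq image_image)
  then show ?thesis using fin by simp
qed

section \<open>Normal subgroups obtained from a finite conjugacy class\<close>

text \<open>All conjugates of \<open>u\<close> are killed by the same exponent \<open>n\<close>, so
  Dietzmann's lemma applies to the class of \<open>u\<close>; it is closed under conjugation and
  generates a normal subgroup.\<close>

lemma (in group) finite_normal_of_torsion_FC:
  assumes K: "K \<lhd> G" and u: "u \<in> FC G K" "u \<noteq> \<one>" "u [^] (n::nat) = \<one>" "0 < n"
  shows "\<exists>F. F \<subseteq> K \<and> F \<lhd> G \<and> finite F \<and> F \<noteq> {\<one>}"
proof -
  let ?C = "conjugacy_class G u"
  have uK: "u \<in> K" "finite ?C" using u by (auto simp: FC_def)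
  have uG: "u \<in> carrier G" using uK K normal_imp_subgroup subgroup.mem_carrier by fast
  note C = conjugacy_class_subset_carrier[OF uG] conjugacy_class_conj[OF uG]
  have "c [^] n = \<one>" if "c \<in> ?C" for c
    using that uG u(3) by (auto simp: conjugacy_class_eq conj_pow[symmetric])
  then have "finite (generate G ?C)"
    using uK C u(4) by (intro finite_generate_torsion) auto
  moreover have "generate G ?C \<lhd> G" using C by (intro normal_generateI) auto
  moreover have "generate G ?C \<subseteq> K"
    using conjugacy_class_subset_normal[OF K uK(1)] K
    by (intro generate_subgroup_incl normal_imp_subgroup)
  moreover have "u \<in> generate G ?C" using uG by (intro generate.incl conjugacy_class_self)
  ultimately show ?thesis using u(2) by blast
qed

lemma (in group) free_abelian_normal_of_torsion_free_FC:
  assumes K: "K \<lhd> G" and u: "u \<in> FC G K" "u \<noteq> \<one>"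
    and torsion_free: "\<And>x n. x \<in> FC G K \<Longrightarrow> 0 < n \<Longrightarrow> x [^] (n::nat) = \<one> \<Longrightarrow> x = \<one>"
  shows "\<exists>A n \<phi>. A \<subseteq> K \<and> A \<lhd> G \<and> A \<noteq> {\<one>} \<and> \<phi> \<in> iso (Zn n) (G\<lparr>carrier := A\<rparr>) \<and>
    finite (induced_hom G A n \<phi> ` carrier G)"
proof -
  let ?C = "conjugacy_class G u"
  interpret FC: subgroup "FC G K" G using K by (rule FC_subgroup)
  have uG: "u \<in> carrier G" using u by simp
  have C: "?C \<subseteq> FC G K" "?C \<subseteq> carrier G" "finite ?C"
    using conjugacy_class_subset_FC[OF K u(1)] u(1) by (auto simp: FC_def)
  obtain m :: nat where m: "0 < m" "\<And>c. c \<in> ?C \<Longrightarrow> u [^] m \<otimes> c = c \<otimes> u [^] m"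
    using pow_commute_finite_classes[OF uG C(3,2)] C(1) by (auto simp: FC_def)
  define B where "B = (\<lambda>c. c [^] m) ` ?C"
  define A where "A = generate G B"
  have BFC: "B \<subseteq> FC G K"
    using C(1) subgroup_int_pow_closed[OF FC.subgroup_axioms, of _ "int m"]
    by (auto simp: B_def int_pow_int)
  then have B: "finite B" "B \<subseteq> carrier G" using C by (auto simp: B_def)
  have "x [^] m \<otimes> y = y \<otimes> x [^] m" if "x \<in> ?C" "y \<in> ?C" for x y
  proof -
    obtain g where g: "g \<in> carrier G" "x = g \<otimes> u \<otimes> inv g"
      using \<open>x \<in> ?C\<close> uG by (auto simp: conjugacy_class_eq)
    \<comment> \<open>Conjugating by \<open>inv g\<close> carries \<open>x\<close> to
      \<open>u\<close> and \<open>y\<close> to another member \<open>z\<close> of the class, where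
      the choice of \<open>m\<close> applies; conjugating back gives the claim for \<open>x\<close>
      and \<open>y\<close>.\<close>
    define z where "z = inv g \<otimes> y \<otimes> inv (inv g)"
    have z: "z \<in> ?C" unfolding z_def using that g uG by (intro conjugacy_class_conj) auto
    have "y = g \<otimes> z \<otimes> inv g" unfolding z_def using that g C(2) by (subst conj_conj) auto
    moreover have "x [^] m = g \<otimes> u [^] m \<otimes> inv g" using g uG by (simp add: conj_pow)
    ultimately show ?thesis
      using m(2)[OF z] g uG z C(2) by (simp add: conj_mult[symmetric] subset_iff)
  qed
  then have "c [^] m \<otimes> d [^] m = d [^] m \<otimes> c [^] m" if "c \<in> ?C" "d \<in> ?C" for c d
    using that C(2) by (intro group_commutes_pow[of d "c [^] m" m, symmetric]) (auto simp: subset_iff)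
  then have "x \<otimes> y = y \<otimes> x" if "x \<in> B" "y \<in> B" for x y
    using that by (auto simp: B_def)
  then interpret A: comm_group "G\<lparr>carrier := A\<rparr>"
    unfolding A_def using B by (intro comm_group_generate)
  have AFC: "A \<subseteq> FC G K"
    unfolding A_def using BFC FC.subgroup_axioms by (rule generate_subgroup_incl)
  have BA: "B \<subseteq> A" by (auto simp: A_def intro: generate.incl)
  \<comment> \<open>Torsion-freeness is inherited from \<open>FC G K\<close>, since powers in the
    subgroup agree with powers in \<open>G\<close>.\<close>
  have "A.torsion_free"
    unfolding A.torsion_free_def
    using torsion_free AFC by (auto simp flip: nat_pow_consistent)
  moreover have "generate (G\<lparr>carrier := A\<rparr>) B = A"
    using generate_consistent[OF BA] generate_is_subgroup[OF B(2)] by (simp add: A_def)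
  ultimately obtain n \<phi> where \<phi>: "\<phi> \<in> iso (Zn n) (G\<lparr>carrier := A\<rparr>)"
    using A.fin_gen_torsion_free_imp_free[of B] B BA by auto
  have norm: "A \<lhd> G"
    unfolding A_def
  proof (rule normal_generateI[OF B(2)])
    fix b g assume "b \<in> B" "g \<in> carrier G"
    then show "g \<otimes> b \<otimes> inv g \<in> B"
      using C(2) uG conjugacy_class_conj[OF uG] by (auto simp: B_def conj_pow subset_iff)
  qed
  \<comment> \<open>Absence of torsion ensures that passing to the \<open>m\<close>-th power does
    not make the subgroup trivial.\<close>
  have "u [^] m \<in> A" "u [^] m \<noteq> \<one>"
    using BA conjugacy_class_self[OF uG] torsion_free[OF u(1) m(1)] u(2) by (auto simp: B_def)
  moreover have "finite (induced_hom G A n \<phi> ` carrier G)"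
    using AFC by (intro finite_induced_hom_image[OF norm \<phi>]) (auto simp: FC_def)
  moreover have "A \<subseteq> K" using AFC by (auto simp: FC_def)
  ultimately show ?thesis using norm \<phi> by blast
qed

theorem proposition1p1:
  fixes G :: "('a, 'b) monoid_scheme" and K :: "'a set"
  assumes "group G" and "K \<lhd> G"
  shows "FC G K \<noteq> {\<one>\<^bsub>G\<^esub>} \<longleftrightarrow>
    (\<exists>F. F \<subseteq> K \<and> F \<lhd> G \<and> finite F \<and> F \<noteq> {\<one>\<^bsub>G\<^esub>}) \<or>
    (\<exists>A n \<phi>. A \<subseteq> K \<and> A \<lhd> G \<and> A \<noteq> {\<one>\<^bsub>G\<^esub>} \<and>
       \<phi> \<in> iso (Zn n) (G\<lparr>carrier := A\<rparr>) \<and>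
       finite (induced_hom G A n \<phi> ` carrier G))"
  (is "?FC \<longleftrightarrow> ?finite \<or> ?free")
proof
  interpret group G by fact
  assume ?FC
  moreover have "\<one>\<^bsub>G\<^esub> \<in> FC G K" using FC_subgroup[OF assms(2)] by (rule subgroup.one_closed)
  ultimately obtain u where u: "u \<in> FC G K" "u \<noteq> \<one>\<^bsub>G\<^esub>" by blast
  show "?finite \<or> ?free"
  \<comment> \<open>Torsion anywhere in \<open>FC G K\<close>, not only in \<open>u\<close>, leads
    to (i); its complete absence is what the construction for (ii) requires.\<close>
  proof (cases "\<exists>x\<in>FC G K. \<exists>n::nat>0. x [^]\<^bsub>G\<^esub> n = \<one>\<^bsub>G\<^esub> \<and> x \<noteq> \<one>\<^bsub>G\<^esub>")
    case True
    then have ?finite using finite_normal_of_torsion_FC[OF assms(2)] by blast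
    then show ?thesis ..
  next
    case False
    then have ?free using u by (intro free_abelian_normal_of_torsion_free_FC[OF assms(2)]) blast+
    then show ?thesis ..
  qed
next
  interpret group G by fact
  have FC_nontrivial: ?FC
    if "N \<lhd> G" "N \<noteq> {\<one>\<^bsub>G\<^esub>}" "N \<subseteq> K" "\<And>a. a \<in> N \<Longrightarrow> finite (conjugacy_class G a)" for N
  proof -
    have "\<one>\<^bsub>G\<^esub> \<in> N" using that(1) by (intro subgroup.one_closed normal_imp_subgroup)
    then show ?thesis using that(2-4) by (auto simp: FC_def)
  qed
  assume "?finite \<or> ?free"
  then show ?FC
  proof
    assume ?finite
    then obtain F where F: "F \<subseteq> K" "F \<lhd> G" "finite F" "F \<noteq> {\<one>\<^bsub>G\<^esub>}" by blast
    \<comment> \<open>A normal subgroup contains the whole class of each of its elements.\<close>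
    then have "finite (conjugacy_class G a)" if "a \<in> F" for a
      using that conjugacy_class_subset_normal finite_subset by metis
    then show ?FC using FC_nontrivial F by blast
  next
    assume ?free
    then show ?FC using FC_nontrivial finite_class_of_finite_image by metis
  qed
qed

end
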